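(* For all non-negative integers $n$, \[ A(n)=B(n)=C(n). \]
   Context: An overpartition of $n$ is a partition of $n$ in which the last occurrence of each distinct number may be overlined. $A(n)$ is the number of overpartitions $\lambda_1+\dots+\lambda_\ell$ of $n$ (parts in non-increasing order of size) such that for every $1\le i\le \ell$, \[ \lambda_i-\lambda_{i+1}\ge \begin{cases}1,&\text{if }\lambda_i\text{ is not overlined},\\ 2,&\text{if }\lambda_i\text{ is overlined},\end{cases} \] where differences are between sizes of parts and by convention $\lambda_{\ell+1}=0$ (so $\overline{1}$ cannot be a part). $B(n)$ is the number of overpartitions of $n$ whose non-overlined parts are all $\equiv 2\pmod 4$ (overlined parts are unrestricted). $C(n)$ is the number of partitions of $n$ into parts $\not\equiv 0\pmod 4$. *)

theory Defs
  imports Main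
begin

definition is_partition :: "nat \<Rightarrow> nat list \<Rightarrow> bool" where
  "is_partition n l \<longleftrightarrow>
     sorted_wrt (\<ge>) l \<and> (\<forall>p \<in> set l. 0 < p) \<and> sum_list l = n"

(* A part of an overpartition is a pair (size, overlined?); the parts are listed in
   non-increasing order of size. *)
type_synonym opart = "nat \<times> bool"

abbreviation size_of :: "opart \<Rightarrow> nat" where
  "size_of p \<equiv> fst p"

abbreviation overlined :: "opart \<Rightarrow> bool" where
  "overlined p \<equiv> snd p"

definition is_overpartition :: "nat \<Rightarrow> opart list \<Rightarrow> bool" where
  "is_overpartition n l \<longleftrightarrow>
     is_partition n (map size_of l) \<and>
     (\<forall>i < length l. overlined (l ! i) \<longrightarrow>
        (\<forall>j < length l. i < j \<longrightarrow> size_of (l ! j) \<noteq> size_of (l ! i)))"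

(* Indices start at 0, so \<lambda>_(i+1) is part_size l i; beyond the last part the size is 0. *)
definition part_size :: "opart list \<Rightarrow> nat \<Rightarrow> nat" where
  "part_size l i = (if i < length l then size_of (l ! i) else 0)"

definition gap_condition :: "opart list \<Rightarrow> bool" where
  "gap_condition l \<longleftrightarrow>
     (\<forall>i < length l. part_size l i - part_size l (i + 1) \<ge> (if overlined (l ! i) then 2 else 1))"

definition A :: "nat \<Rightarrow> nat" where
  "A n = card {l. is_overpartition n l \<and> gap_condition l}"

definition B :: "nat \<Rightarrow> nat" where
  "B n = card {l. is_overpartition n l \<and>
     (\<forall>p \<in> set l. \<not> overlined p \<longrightarrow> size_of p mod 4 = 2)}"

definition C :: "nat \<Rightarrow> nat" where
  "C n = card {l. is_partition n l \<and> (\<forall>p \<in> set l. p mod 4 \<noteq> 0)}"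

(* The following two facts show that A, B and C are cardinalities of finite sets. *)
lemma finite_partitions: "finite {l. is_partition n l}"
proof (rule finite_subset)
  have len: "length l \<le> sum_list l" if "\<forall>p \<in> set l. 0 < p" for l :: "nat list"
    using that by (induction l) auto
  show "{l. is_partition n l} \<subseteq> {l. set l \<subseteq> {..n} \<and> length l \<le> n}"
    using len by (auto simp: is_partition_def member_le_sum_list)
  show "finite {l :: nat list. set l \<subseteq> {..n} \<and> length l \<le> n}"
    by (rule finite_lists_length_le) simp
qed

lemma finite_overpartitions: "finite {l. is_overpartition n l}"
proof (rule finite_subset)
  have len: "length l \<le> sum_list l" if "\<forall>p \<in> set l. 0 < p" for l :: "nat list"
    using that by (induction l) auto
  show "{l. is_overpartition n l} \<subseteq> {l. set l \<subseteq> {..n} \<times> UNIV \<and> length l \<le> n}"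
  proof (rule subsetI, rule CollectI, rule conjI)
    fix l assume "l \<in> {l. is_overpartition n l}"
    then have l: "is_partition n (map size_of l)"
      by (simp add: is_overpartition_def)
    have "size_of p \<le> n" if "p \<in> set l" for p
      using l that member_le_sum_list[of "size_of p" "map size_of l"]
      by (auto simp: is_partition_def)
    then show "set l \<subseteq> {..n} \<times> UNIV" by auto
    show "length l \<le> n"
      using l len[of "map size_of l"] by (auto simp: is_partition_def)
  qed
  show "finite {l :: opart list. set l \<subseteq> {..n} \<times> UNIV \<and> length l \<le> n}"
    by (rule finite_lists_length_le) simp
qed

end

(* A part m of a partition counted by A allows both states exactly when the gap below it is at
   least 2. Removing the largest part therefore gives, for the generating polynomial a N of the
   partitions with parts at most N, the recurrence
     a (N + 2) = (1 + q^(N+2)) a (N + 1) + q^(N+2) a N,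
   which is solved by the finite form of Lebesgue's identity
     a N = sum_k q^(k(k+1)) [N - k choose k] prod_(k < i <= N - k) (1 + q^i).
   Modulo q^(n+1) and for large N the k-th summand agrees with the k-th summand of
     prod_(i <= N) (1 + q^i) * sum_k q^(k(k+1)) [M choose k]_(q^2)
       = prod_(i <= N) (1 + q^i) * prod_(i <= M) (1 + q^(2i)),
   because both become equal after multiplication by prod_(i <= k) (1 - q^(2i)). Euler's
   identity prod (1 + q^i) = 1 / prod (1 - q^(2i-1)), for q and for q^2, turns this product into
   the generating functions of B and C. *)

theory Submission
  imports Defs "HOL-Computational_Algebra.Formal_Power_Series"
begin

section \<open>Finite q-series identities\<close>

text \<open>\<open>qbin q m k\<close> is the Gaussian binomial coefficient of \<open>m + k\<close> over \<open>k\<close>; indexing by \<open>m\<close>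
  instead of \<open>m + k\<close> avoids truncated subtraction.\<close>

fun qbin :: "'a::comm_ring_1 \<Rightarrow> nat \<Rightarrow> nat \<Rightarrow> 'a" where
  "qbin q 0 k = 1"
| "qbin q (Suc m) 0 = 1"
| "qbin q (Suc m) (Suc k) = qbin q m (Suc k) + q ^ Suc m * qbin q (Suc m) k"

lemma qbin_0_right [simp]: "qbin q m 0 = 1"
  by (cases m) simp_all

text \<open>Relates the neighbours [m+k+1 choose k+1] and [m+k+1 choose k] of one row. The induction
  follows the Pascal rule that defines \<open>qbin\<close>, so no quotient is formed and any
  \<open>q\<close> in any commutative ring is allowed.\<close>

lemma qbin_absorb:
  "(1 - q ^ Suc k) * qbin q m (Suc k) = (1 - q ^ Suc m) * qbin q (Suc m) k"
proof (induction q m k rule: qbin.induct)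
  case (1 q k)
  have "(1 - q) * qbin q (Suc 0) k = 1 - q ^ Suc k"
  proof (induction k)
    case (Suc k)
    have "(1 - q) * qbin q (Suc 0) (Suc k) = 1 - q + q * ((1 - q) * qbin q (Suc 0) k)"
      by (simp add: algebra_simps)
    then show ?case unfolding Suc.IH by (simp add: algebra_simps)
  qed simp
  then show ?case by simp
next
  case (2 q m)
  have "(1 - q) * qbin q m (Suc 0) = 1 - q ^ Suc m" for m
  proof (induction m)
    case (Suc m)
    have "(1 - q) * qbin q (Suc m) (Suc 0) = (1 - q) * qbin q m (Suc 0) + (1 - q) * q ^ Suc m"
      by (simp add: distrib_left)
    also have "\<dots> = 1 - q ^ Suc (Suc m)"
      unfolding Suc.IH by (simp add: algebra_simps)
    finally show ?case .
  qed simp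
  from this[of "Suc m"] show ?case by (simp del: qbin.simps(3))
next
  case (3 q m k)
  have "(1 - q ^ Suc (Suc k)) * qbin q (Suc m) (Suc (Suc k))
      = (1 - q ^ Suc (Suc k)) * qbin q m (Suc (Suc k))
        + (1 - q ^ Suc (Suc k)) * (q ^ Suc m * qbin q (Suc m) (Suc k))"
    by (simp add: distrib_left)
  \<comment> \<open>The first induction hypothesis merges both summands into the factor 1 -
    q^(m+k+3). Splitting it as (1 - q^(m+2)) + q^(m+2) (1 - q^(k+1)) then prepares the second
    one.\<close>
  also have "\<dots> = (1 - q ^ (m + k + 3)) * qbin q (Suc m) (Suc k)"
    unfolding "3.IH"(1) by (simp add: algebra_simps power_add numeral_3_eq_3 del: qbin.simps)
  also have "\<dots> = (1 - q ^ Suc (Suc m)) * qbin q (Suc m) (Suc k)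
        + q ^ Suc (Suc m) * ((1 - q ^ Suc k) * qbin q (Suc m) (Suc k))"
    by (simp add: algebra_simps power_add numeral_3_eq_3 del: qbin.simps)
  also have "\<dots> = (1 - q ^ Suc (Suc m)) * qbin q (Suc (Suc m)) (Suc k)"
    unfolding "3.IH"(2) qbin.simps(3)[of q "Suc m" k] by (simp only: algebra_simps)
  finally show ?case .
qed

text \<open>The mirrored Pascal rule; it differs from the defining one exactly by
  \<open>qbin_absorb\<close>.\<close>

lemma qbin_pascal:
  "qbin q (Suc m) (Suc k) = q ^ Suc k * qbin q m (Suc k) + qbin q (Suc m) k"
  using qbin_absorb[of q k m] by (simp add: algebra_simps)

text \<open>The quotient formula for Gaussian binomials with the denominator cleared. Each
  absorption lowers k and raises m by one, hence the generalization over \<open>m\<close>.\<close>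

lemma qbin_prod:
  "qbin q m k * (\<Prod>i<k. 1 - q ^ Suc i) = (\<Prod>i<k. 1 - q ^ Suc (m + i))"
proof (induction k arbitrary: m)
  case (Suc k)
  have "qbin q m (Suc k) * (\<Prod>i<Suc k. 1 - q ^ Suc i)
      = (1 - q ^ Suc k) * qbin q m (Suc k) * (\<Prod>i<k. 1 - q ^ Suc i)"
    by (simp only: prod.lessThan_Suc ac_simps)
  also have "\<dots> = (1 - q ^ Suc m) * (qbin q (Suc m) k * (\<Prod>i<k. 1 - q ^ Suc i))"
    unfolding qbin_absorb by (simp only: ac_simps)
  also have "\<dots> = (\<Prod>i<Suc k. 1 - q ^ Suc (m + i))"
    unfolding Suc.IH by (subst prod.lessThan_Suc_shift) simp
  finally show ?case .
qed simp

text \<open>The q-binomial theorem in base q^2, with \<open>qbin (q ^ 2) (M - k) k\<close> =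
  [M choose k]. The Pascal rule splits off the last factor 1 + q^(2(M+1)). The free bound
  \<open>K\<close> lets the sums for M and M + 1 share an index range.\<close>

lemma euler_finite:
  fixes q :: "'a::comm_ring_1"
  assumes "M \<le> K"
  shows "(\<Sum>k\<le>K. if k \<le> M then q ^ (k * Suc k) * qbin (q ^ 2) (M - k) k else 0)
       = (\<Prod>i<M. 1 + q ^ (2 * Suc i))"
  using assms
proof (induction M arbitrary: K)
  case 0
  then show ?case by simp
next
  case (Suc M)
  define t where "t M k = (if k \<le> M then q ^ (k * Suc k) * qbin (q ^ 2) (M - k) k else 0)" for M k
  from Suc.prems obtain L where K: "K = Suc L" and L: "M \<le> L" by (cases K) auto
  have step: "t (Suc M) (Suc k) = t M (Suc k) + q ^ (2 * Suc M) * t M k" for k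
  proof (cases "Suc k \<le> M")
    case True
    then obtain d where M: "M = Suc (k + d)" by (auto simp: le_iff_add)
    show ?thesis
      by (simp add: t_def M Suc_diff_le power_add algebra_simps power2_eq_square
        power_mult_distrib mult_2_right flip: power_mult)
  next
    case False
    then show ?thesis
      by (cases "k = M") (simp_all add: t_def power_add algebra_simps power2_eq_square mult_2_right)
  qed
  have t00: "t (Suc M) 0 = t M 0"
    by (simp add: t_def)
  have "(\<Sum>k\<le>K. t (Suc M) k) = t M 0 + (\<Sum>k\<le>L. t M (Suc k)) + q ^ (2 * Suc M) * (\<Sum>k\<le>L. t M k)"
    unfolding K by (subst sum.atMost_Suc_shift)
      (simp add: step sum.distrib t00 del: power_Suc flip: sum_distrib_left)
  also have "t M 0 + (\<Sum>k\<le>L. t M (Suc k)) = (\<Sum>k\<le>K. t M k)"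
    unfolding K by (subst sum.atMost_Suc_shift) simp
  finally show ?case
    using Suc.IH[of K] Suc.IH[OF L] Suc.prems by (simp add: t_def algebra_simps)
qed

section \<open>Finite form of Lebesgue's identity\<close>

text \<open>With \<open>N = m + 2 * k\<close>, this is the \<open>k\<close>-th summand in the closed form of \<open>a N\<close>.\<close>

definition lterm :: "'a::comm_ring_1 \<Rightarrow> nat \<Rightarrow> nat \<Rightarrow> 'a" where
  "lterm q m k = q ^ (k * Suc k) * qbin q m k * (\<Prod>i<m. 1 + q ^ Suc (k + i))"

text \<open>This and the next lemma are the edges k = 0 and m = 0 of the termwise recurrence, where
  one of the two earlier terms is absent.\<close>

lemma lterm_Suc_0: "lterm q (Suc m) 0 = (1 + q ^ Suc m) * lterm q m 0"
  by (simp add: lterm_def algebra_simps)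

lemma lterm_0_Suc: "lterm q 0 (Suc k) = q ^ (2 * Suc k) * lterm q 0 k"
  by (simp add: lterm_def power_add algebra_simps power2_eq_square mult_2_right)

text \<open>The recurrence of \<open>a\<close> holds summand by summand: the three terms have m + 2k
  equal to N + 2, N + 1 and N for N = m + 2k + 1. Expanding the last factor 1 + q^(m+k+2) of the
  product, one Pascal rule is applied to each of the two summands.\<close>

lemma lterm_Suc_Suc:
  "lterm q (Suc m) (Suc k)
     = (1 + q ^ (m + 2 * k + 3)) * lterm q m (Suc k) + q ^ (m + 2 * k + 3) * lterm q (Suc m) k"
proof -
  let ?P = "\<Prod>i<m. 1 + q ^ Suc (Suc k + i)"
  let ?x = "qbin q m (Suc k)" and ?y = "qbin q (Suc m) k" and ?z = "qbin q (Suc m) (Suc k)"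
  have "?z * (1 + q ^ (m + k + 2)) = ?z + q ^ (m + k + 2) * ?z"
    by (simp add: algebra_simps)
  also have "\<dots> = (?x + q ^ Suc m * ?y) + q ^ (m + k + 2) * (q ^ Suc k * ?x + ?y)"
    by (subst (2) qbin_pascal) simp
  also have "\<dots> = (1 + q ^ (m + 2 * k + 3)) * ?x + q ^ Suc m * (1 + q ^ Suc k) * ?y"
    by (simp add: algebra_simps power_add mult_2 numeral_3_eq_3 numeral_2_eq_2 del: qbin.simps)
  finally have *: "?z * (1 + q ^ (m + k + 2))
    = (1 + q ^ (m + 2 * k + 3)) * ?x + q ^ Suc m * (1 + q ^ Suc k) * ?y" .
  have "lterm q (Suc m) (Suc k) = q ^ (Suc k * Suc (Suc k)) * ?P * (?z * (1 + q ^ (m + k + 2)))"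
    by (simp add: lterm_def ac_simps del: qbin.simps)
  also have "\<dots> = (1 + q ^ (m + 2 * k + 3)) * (q ^ (Suc k * Suc (Suc k)) * ?x * ?P)
     + (q ^ (Suc k * Suc (Suc k)) * q ^ Suc m) * (?y * ((1 + q ^ Suc k) * ?P))"
    unfolding * by (simp only: algebra_simps)
  \<comment> \<open>The factor 1 + q^(k+1) left over by the Pascal rules is the one by which the
    product at level k exceeds \<open>?P\<close>.\<close>
  also have "(1 + q ^ Suc k) * ?P = (\<Prod>i<Suc m. 1 + q ^ Suc (k + i))"
    by (subst prod.lessThan_Suc_shift) simp
  also have "q ^ (Suc k * Suc (Suc k)) * q ^ Suc m = q ^ (m + 2 * k + 3) * q ^ (k * Suc k)"
    unfolding power_add[symmetric] by (rule arg_cong[of _ _ "power q"]) simp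
  finally show ?thesis by (simp only: lterm_def ac_simps)
qed

lemma lebesgue_finite:
  fixes a :: "nat \<Rightarrow> 'a::comm_ring_1"
  assumes a: "a 0 = 1" "a (Suc 0) = 1 + q"
    "\<And>N. a (Suc (Suc N)) = (1 + q ^ Suc (Suc N)) * a (Suc N) + q ^ Suc (Suc N) * a N"
    and "N \<le> 2 * K + 1"
  shows "a N = (\<Sum>k\<le>K. if 2 * k \<le> N then lterm q (N - 2 * k) k else 0)"
  using assms(4)
proof (induction N arbitrary: K rule: induct_nat_012)
  case 0
  have "(\<Sum>k\<le>K. if 2 * k \<le> 0 then lterm q (0 - 2 * k) k else 0) = (\<Sum>k\<in>{0}. lterm q 0 k)"
    by (rule sum.mono_neutral_cong_right) auto
  then show ?case by (simp add: a lterm_def)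
next
  case 1
  have "(\<Sum>k\<le>K. if 2 * k \<le> Suc 0 then lterm q (Suc 0 - 2 * k) k else 0)
    = (\<Sum>k\<in>{0}. lterm q (Suc 0) k)"
    by (rule sum.mono_neutral_cong_right) auto
  then show ?case by (simp add: a lterm_def)
next
  case (ge2 N)
  define t where "t N k = (if 2 * k \<le> N then lterm q (N - 2 * k) k else 0)" for N k
  let ?x = "q ^ Suc (Suc N)"
  from ge2.prems obtain L where K: "K = Suc L" and L: "N \<le> 2 * L + 1" by (cases K) auto
  \<comment> \<open>Beyond the interior case, the only nonzero possibility is N = 2k, the edge m =
    0.\<close>
  have step: "t (Suc (Suc N)) (Suc k) = (1 + ?x) * t (Suc N) (Suc k) + ?x * t N k" for k
  proof (cases "2 * Suc k \<le> Suc N")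
    case True
    then obtain d where "Suc N = 2 * Suc k + d" by (auto simp: le_iff_add)
    then have "N = d + 2 * k + 1" by simp
    then show ?thesis
      using lterm_Suc_Suc[of q d k] by (simp add: t_def numeral_3_eq_3)
  next
    case False
    then show ?thesis
      using lterm_0_Suc[of q k] by (cases "2 * k = N") (auto simp: t_def)
  qed
  have "t (Suc (Suc N)) 0 = (1 + ?x) * t (Suc N) 0"
    by (simp add: t_def lterm_Suc_0)
  then have "(\<Sum>k\<le>K. t (Suc (Suc N)) k) = (1 + ?x) * (t (Suc N) 0 + (\<Sum>k\<le>L. t (Suc N) (Suc k)))
      + ?x * (\<Sum>k\<le>L. t N k)"
    unfolding K by (subst sum.atMost_Suc_shift)
      (simp add: step sum.distrib distrib_left add.assoc flip: sum_distrib_left)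
  also have "t (Suc N) 0 + (\<Sum>k\<le>L. t (Suc N) (Suc k)) = (\<Sum>k\<le>K. t (Suc N) k)"
    unfolding K by (subst sum.atMost_Suc_shift) simp
  finally show ?case
    using ge2.IH(1)[OF L] ge2.IH(2)[of K] ge2.prems by (simp add: t_def a)
qed

text \<open>Finite form of Euler's theorem on odd and distinct parts; the right side tends to 1.
  Going to M + 1 removes the factor 1 - q^(M+1) from it, which pairs with 1 + q^(M+1) to give the
  new top factor 1 - q^(2M+2).\<close>

lemma euler_odd_finite:
  fixes q :: "'a::comm_ring_1"
  shows "(\<Prod>i<M. 1 - q ^ (2 * i + 1)) * (\<Prod>i<M. 1 + q ^ Suc i) = (\<Prod>i<M. 1 - q ^ Suc (M + i))"
proof (induction M)
  case (Suc M)
  have "(\<Prod>i<Suc M. 1 - q ^ (2 * i + 1)) * (\<Prod>i<Suc M. 1 + q ^ Suc i)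
     = (\<Prod>i<M. 1 - q ^ Suc (M + i)) * (1 - q ^ (2 * M + 1)) * (1 + q ^ Suc M)"
    unfolding Suc.IH[symmetric] by (simp only: prod.lessThan_Suc ac_simps)
  also have "\<dots> = (\<Prod>i<Suc M. 1 - q ^ Suc (M + i)) * (1 + q ^ Suc M)"
    by (simp add: mult_2)
  also have "\<dots> = (\<Prod>i<M. 1 - q ^ Suc (Suc M + i)) * ((1 - q ^ Suc M) * (1 + q ^ Suc M))"
    by (subst prod.lessThan_Suc_shift) (simp add: ac_simps)
  also have "(1 - q ^ Suc M) * (1 + q ^ Suc M) = 1 - q ^ Suc (Suc M + M)"
    by (simp add: algebra_simps power_add)
  finally show ?case by simp
qed simp

section \<open>Congruence of power series modulo a power of X\<close>

text \<open>Agreement of the coefficients up to n, encoded as divisibility so that compatibility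
  with the ring operations comes from \<open>dvd\<close>.\<close>

definition cong_upto :: "nat \<Rightarrow> rat fps \<Rightarrow> rat fps \<Rightarrow> bool" where
  "cong_upto n f g \<longleftrightarrow> fps_X ^ Suc n dvd f - g"

lemma cong_upto_refl [simp]: "cong_upto n f f"
  by (simp add: cong_upto_def)

lemma cong_upto_sym: "cong_upto n f g \<Longrightarrow> cong_upto n g f"
  unfolding cong_upto_def by (metis dvd_minus_iff minus_diff_eq)

lemma cong_upto_trans [trans]: "cong_upto n f g \<Longrightarrow> cong_upto n g h \<Longrightarrow> cong_upto n f h"
  unfolding cong_upto_def using dvd_add[of _ "f - g" "g - h"] by simp

lemma cong_upto_add: "cong_upto n f g \<Longrightarrow> cong_upto n f' g' \<Longrightarrow> cong_upto n (f + f') (g + g')"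
  unfolding cong_upto_def add_diff_add by (rule dvd_add)

lemma cong_upto_mult:
  assumes "cong_upto n f g" "cong_upto n f' g'"
  shows "cong_upto n (f * f') (g * g')"
proof -
  have "f * f' - g * g' = (f - g) * f' + g * (f' - g')"
    by (simp add: algebra_simps)
  then show ?thesis
    using assms by (simp add: cong_upto_def)
qed

lemma cong_upto_sum: "(\<And>i. i \<in> S \<Longrightarrow> cong_upto n (f i) (g i)) \<Longrightarrow> cong_upto n (sum f S) (sum g S)"
  by (induction S rule: infinite_finite_induct) (auto intro: cong_upto_add)

lemma cong_upto_prod: "(\<And>i. i \<in> S \<Longrightarrow> cong_upto n (f i) (g i)) \<Longrightarrow> cong_upto n (prod f S) (prod g S)"
  by (induction S rule: infinite_finite_induct) (auto intro: cong_upto_mult)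

lemma cong_upto_nth: "cong_upto n f g \<Longrightarrow> fps_nth f n = fps_nth g n"
proof -
  assume "cong_upto n f g"
  then obtain h where "f - g = fps_X ^ Suc n * h"
    by (auto simp: cong_upto_def)
  then have "fps_nth (f - g) n = 0"
    by (simp only: fps_X_power_mult_nth) simp
  then show ?thesis by simp
qed

text \<open>A series with nonzero constant term is a unit. This is how denominators are removed in
  the comparison of summands.\<close>

lemma cong_upto_cancel:
  assumes "cong_upto n (u * f) (u * g)" and u: "fps_nth u 0 \<noteq> 0"
  shows "cong_upto n f g"
proof -
  have "inverse u * u = 1"
    using u by (rule inverse_mult_eq_1)
  then have "inverse u * (u * h) = h" for h
    by (metis mult.assoc mult_1)
  then show ?thesis
    using cong_upto_mult[OF cong_upto_refl assms(1), of "inverse u"] by (simp only:)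
qed

lemma cong_upto_X_power_mult: "n < e \<Longrightarrow> cong_upto n (fps_X ^ e * f) 0"
  by (simp add: cong_upto_def le_imp_power_dvd dvd_mult2 del: power_Suc)

lemma cong_upto_prod_1:
  assumes "\<And>i. i \<in> S \<Longrightarrow> n < e i"
  shows "cong_upto n (\<Prod>i\<in>S. 1 + fps_X ^ e i) 1" "cong_upto n (\<Prod>i\<in>S. 1 - fps_X ^ e i) 1"
proof -
  have "cong_upto n (1 + fps_X ^ e i) 1" "cong_upto n (1 - fps_X ^ e i) 1" if "i \<in> S" for i
    using le_imp_power_dvd[of "Suc n" "e i" "fps_X :: rat fps"] assms[OF that]
    by (simp_all add: cong_upto_def del: power_Suc)
  then show "cong_upto n (\<Prod>i\<in>S. 1 + fps_X ^ e i) 1" "cong_upto n (\<Prod>i\<in>S. 1 - fps_X ^ e i) 1"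
    using cong_upto_prod[of S n _ "\<lambda>_. 1"] by simp_all
qed

section \<open>Comparison of the Lebesgue sum with a product\<close>

lemma prod_lessThan_add:
  fixes f :: "nat \<Rightarrow> 'a::comm_monoid_mult"
  shows "prod f {..<a + b} = prod f {..<a} * (\<Prod>i<b. f (a + i))"
  by (induction b) (simp_all add: ac_simps)

text \<open>For k > n both sides contain X^(k(k+1)), which vanishes to this precision. For k <= n
  the bounds give N - 2k >= n and M - k >= n, so all factors in which the two sides differ after
  multiplication by \<open>U\<close> have exponents above n.\<close>

lemma cong_upto_lterm:
  assumes N: "4 * n \<le> N" and M: "2 * n \<le> M"
  shows "cong_upto n (if 2 * k \<le> N then lterm fps_X (N - 2 * k) k else 0)
    (if k \<le> M then fps_X ^ (k * Suc k) * qbin (fps_X ^ 2) (M - k) k * (\<Prod>i<N. 1 + fps_X ^ Suc i) else 0)"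
proof (cases "k \<le> n")
  case False
  then have "n < k * Suc k" by simp
  then have *: "cong_upto n (fps_X ^ (k * Suc k) * f) 0" for f
    by (rule cong_upto_X_power_mult)
  have "cong_upto n (if 2 * k \<le> N then lterm fps_X (N - 2 * k) k else 0) 0"
    unfolding lterm_def mult.assoc using * by (auto simp del: mult_Suc_right power_Suc)
  moreover have "cong_upto n (if k \<le> M then fps_X ^ (k * Suc k) * qbin (fps_X ^ 2) (M - k) k
      * (\<Prod>i<N. 1 + fps_X ^ Suc i) else 0) 0"
    unfolding mult.assoc using * by (auto simp del: mult_Suc_right power_Suc)
  ultimately show ?thesis
    by (blast intro: cong_upto_trans cong_upto_sym)
next
  case True
  let ?X = "fps_X :: rat fps"
  let ?e = "?X ^ (k * Suc k)"
  define P where "P r = (\<Prod>i<r. 1 + ?X ^ Suc i)" for r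
  define U where "U = (\<Prod>i<k. 1 - (?X ^ 2) ^ Suc i)"
  define m where "m = N - 2 * k"
  have Nm: "N = (k + m) + k" and m: "n \<le> m" and kM: "k \<le> M" "n \<le> M - k"
    using N M True by (auto simp: m_def)
  have "1 - (x ^ 2) ^ j = (1 - x ^ j) * (1 + x ^ j)" for x :: "rat fps" and j
    by (simp add: algebra_simps power2_eq_square power_mult_distrib)
  \<comment> \<open>One half of \<open>U\<close> clears the denominator of
    \<open>qbin ?X m k\<close>; the other half, \<open>P k\<close>, supplies the low factors missing
    from the product in \<open>lterm\<close>.\<close>
  then have U: "U = (\<Prod>i<k. 1 - ?X ^ Suc i) * P k"
    by (simp only: U_def P_def prod.distrib)
  have "U * lterm ?X m k
      = ?e * (qbin ?X m k * (\<Prod>i<k. 1 - ?X ^ Suc i)) * (P k * (\<Prod>i<m. 1 + ?X ^ Suc (k + i)))"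
    by (simp add: U lterm_def ac_simps)
  also have "\<dots> = ?e * (\<Prod>i<k. 1 - ?X ^ Suc (m + i)) * P (k + m)"
    by (simp only: qbin_prod P_def prod_lessThan_add)
  also have "cong_upto n \<dots> (?e * 1 * P (k + m))"
    using m by (intro cong_upto_mult cong_upto_prod_1 cong_upto_refl) simp
  also have "cong_upto n (?e * 1 * P (k + m)) (?e * 1 * P N)"
  proof -
    have "cong_upto n (P (k + m) * 1) (P (k + m) * (\<Prod>i<k. 1 + ?X ^ Suc (k + m + i)))"
      using m by (intro cong_upto_mult cong_upto_sym[OF cong_upto_prod_1(1)] cong_upto_refl) simp
    then have "cong_upto n (P (k + m)) (P N)"
      unfolding Nm by (simp add: P_def prod_lessThan_add[of _ "k + m" k])
    then show ?thesis by (intro cong_upto_mult cong_upto_refl)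
  qed
  \<comment> \<open>The factor 1 is traded back for the product that \<open>qbin_prod\<close> in
    base X^2 turns into a Gaussian binomial times \<open>U\<close>.\<close>
  also have "cong_upto n (?e * 1 * P N) (?e * (\<Prod>i<k. 1 - ?X ^ (2 * Suc (M - k + i))) * P N)"
    using kM by (intro cong_upto_mult cong_upto_sym[OF cong_upto_prod_1(2)] cong_upto_refl) simp
  also have "?e * (\<Prod>i<k. 1 - ?X ^ (2 * Suc (M - k + i))) * P N
      = ?e * (qbin (?X ^ 2) (M - k) k * U) * P N"
    unfolding U_def qbin_prod by (simp only: power_mult)
  finally have "cong_upto n (U * lterm ?X m k) (U * (?e * qbin (?X ^ 2) (M - k) k * P N))"
    by (simp add: ac_simps)
  moreover have "fps_nth U 0 \<noteq> 0"
    unfolding U_def by (induction k) simp_all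
  ultimately have "cong_upto n (lterm ?X m k) (?e * qbin (?X ^ 2) (M - k) k * P N)"
    by (rule cong_upto_cancel)
  moreover have "2 * k \<le> N"
    using Nm by linarith
  ultimately show ?thesis
    using kM(1) by (simp add: m_def P_def del: power_Suc)
qed

lemma lebesgue_cong_upto:
  fixes a :: "nat \<Rightarrow> rat fps"
  assumes "a 0 = 1" "a (Suc 0) = 1 + fps_X"
    "\<And>N. a (Suc (Suc N)) = (1 + fps_X ^ Suc (Suc N)) * a (Suc N) + fps_X ^ Suc (Suc N) * a N"
    and N: "4 * n \<le> N" and M: "2 * n \<le> M"
  shows "cong_upto n (a N) ((\<Prod>i<N. 1 + fps_X ^ Suc i) * (\<Prod>i<M. 1 + fps_X ^ (2 * Suc i)))"
proof -
  \<comment> \<open>The bound N + M is large enough for both \<open>lebesgue_finite\<close> and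
    \<open>euler_finite\<close>.\<close>
  have "a N = (\<Sum>k\<le>N + M. if 2 * k \<le> N then lterm fps_X (N - 2 * k) k else 0)"
    by (rule lebesgue_finite[OF assms(1-3)]) auto
  also have "cong_upto n \<dots> (\<Sum>k\<le>N + M. if k \<le> M then fps_X ^ (k * Suc k)
      * qbin (fps_X ^ 2) (M - k) k * (\<Prod>i<N. 1 + fps_X ^ Suc i) else 0)"
    using N M by (intro cong_upto_sum cong_upto_lterm)
  also have "\<dots> = (\<Prod>i<N. 1 + fps_X ^ Suc i) * (\<Sum>k\<le>N + M. if k \<le> M then fps_X ^ (k * Suc k)
      * qbin (fps_X ^ 2) (M - k) k else 0)"
    unfolding sum_distrib_left by (intro sum.cong) (simp_all add: ac_simps)
  also have "\<dots> = (\<Prod>i<N. 1 + fps_X ^ Suc i) * (\<Prod>i<M. 1 + fps_X ^ (2 * Suc i))"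
    by (subst euler_finite) simp_all
  finally show ?thesis .
qed

section \<open>Generating functions of the three classes\<close>

text \<open>Since \<open>card\<close> is 0 on infinite sets, this counts properly only when each
  weight class is finite; hence the finiteness conditions in \<open>gf_Un\<close>.\<close>

definition gf :: "('a \<Rightarrow> nat) \<Rightarrow> 'a set \<Rightarrow> rat fps" where
  "gf w S = Abs_fps (\<lambda>n. of_nat (card {x \<in> S. w x = n}))"

lemma gf_Un:
  assumes "\<And>n. finite {x \<in> S. w x = n}" "\<And>n. finite {x \<in> T. w x = n}" "S \<inter> T = {}"
  shows "gf w (S \<union> T) = gf w S + gf w T"
proof -
  have "{x \<in> S \<union> T. w x = n} = {x \<in> S. w x = n} \<union> {x \<in> T. w x = n}" for n
    by auto
  moreover have "{x \<in> S. w x = n} \<inter> {x \<in> T. w x = n} = {}" for n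
    using assms(3) by auto
  ultimately show ?thesis
    using assms(1,2) by (simp add: gf_def fps_eq_iff card_Un_disjoint)
qed

lemma gf_image:
  assumes "inj f" and w: "\<And>x. w (f x) = d + w x"
  shows "gf w (f ` S) = fps_X ^ d * gf w S"
proof (rule fps_ext)
  fix n
  have "{y \<in> f ` S. w y = n} = (if n < d then {} else f ` {x \<in> S. w x = n - d})"
    using w by (auto split: if_splits)
  moreover have "card (f ` {x \<in> S. w x = n - d}) = card {x \<in> S. w x = n - d}"
    using assms(1) by (intro card_image) (meson inj_on_subset subset_UNIV)
  ultimately show "fps_nth (gf w (f ` S)) n = fps_nth (fps_X ^ d * gf w S) n"
    by (simp add: gf_def fps_X_power_mult_nth)
qed

lemma gf_singleton: "w x = 0 \<Longrightarrow> gf w {x} = 1"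
  by (rule fps_ext) (auto simp: gf_def Collect_conv_if)

section \<open>Overpartitions and partitions with bounded parts\<close>

abbreviation weight :: "opart list \<Rightarrow> nat" where
  "weight l \<equiv> sum_list (map fst l)"

definition overpartition :: "opart list \<Rightarrow> bool" where
  "overpartition l \<longleftrightarrow> is_overpartition (weight l) l"

lemma is_overpartition_iff_weight: "is_overpartition n l \<longleftrightarrow> overpartition l \<and> weight l = n"
  by (auto simp: overpartition_def is_overpartition_def is_partition_def)

lemma overpartition_Nil [simp]: "overpartition []"
  by (simp add: overpartition_def is_overpartition_def is_partition_def)

lemma overpartition_Cons: "overpartition (p # l) \<longleftrightarrow>
    overpartition l \<and> 0 < fst p \<and> (\<forall>r\<in>set l. fst r \<le> fst p \<and> (snd p \<longrightarrow> fst r \<noteq> fst p))"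
  by (simp add: overpartition_def is_overpartition_def is_partition_def All_less_Suc2
      all_set_conv_all_nth) blast

text \<open>Here and in \<open>BP\<close> and \<open>CP\<close> the total is left free and only the
  part sizes are bounded, so that recursion on N can split off a largest part.\<close>

definition AP :: "nat \<Rightarrow> opart list set" where
  "AP N = {l. overpartition l \<and> gap_condition l \<and> (\<forall>p\<in>set l. fst p \<le> N)}"

definition BP :: "nat \<Rightarrow> opart list set" where
  "BP N = {l. overpartition l \<and> (\<forall>p\<in>set l. \<not> snd p \<longrightarrow> fst p mod 4 = 2) \<and> (\<forall>p\<in>set l. fst p \<le> N)}"

definition CP :: "nat \<Rightarrow> nat list set" where
  "CP N = {l. is_partition (sum_list l) l \<and> (\<forall>p\<in>set l. p mod 4 \<noteq> 0) \<and> (\<forall>p\<in>set l. p \<le> N)}"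

lemma gap_condition_Cons: "gap_condition (p # l) \<longleftrightarrow>
    (if snd p then 2 else 1) \<le> fst p - part_size l 0 \<and> gap_condition l"
  by (simp add: gap_condition_def All_less_Suc2 part_size_def)

text \<open>The first part is the largest; for the empty list the default size 0 makes both sides
  true.\<close>

lemma part_size_0_le_iff:
  "overpartition l \<Longrightarrow> part_size l 0 \<le> k \<longleftrightarrow> (\<forall>r\<in>set l. fst r \<le> k)"
  by (cases l) (auto simp: part_size_def overpartition_Cons intro: order_trans)

text \<open>A gap g > 0 below the head already forces the ordering and overlining conditions there.
  The clause \<open>g \<le> fst p\<close> keeps truncated subtraction honest and excludes an
  overlined 1.\<close>

lemma overpartition_gap_condition_Cons:
  "overpartition (p # l) \<and> gap_condition (p # l) \<longleftrightarrow> overpartition l \<and> gap_condition l \<and>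
     (let g = if snd p then 2 else 1 in g \<le> fst p \<and> (\<forall>r\<in>set l. fst r \<le> fst p - g))"
proof (cases "overpartition l")
  case True
  define g :: nat where "g = (if snd p then 2 else 1)"
  have "0 < g" by (simp add: g_def)
  then have gap: "g \<le> fst p - part_size l 0 \<longleftrightarrow> g \<le> fst p \<and> (\<forall>r\<in>set l. fst r \<le> fst p - g)"
    unfolding part_size_0_le_iff[OF True, symmetric] by linarith
  have *: "0 < fst p \<and> (r \<le> fst p - g \<longrightarrow> r \<le> fst p \<and> r \<noteq> fst p)" if "g \<le> fst p" for r
    using that \<open>0 < g\<close> by auto
  show ?thesis
    unfolding overpartition_Cons gap_condition_Cons Let_def g_def[symmetric] gap
    using True * by blast
next
  case False
  then show ?thesis by (simp add: overpartition_Cons)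
qed

lemma Nil_in_AP [simp]: "[] \<in> AP N"
  by (simp add: AP_def gap_condition_def)

lemma Nil_in_BP [simp]: "[] \<in> BP N"
  by (simp add: BP_def)

lemma Nil_in_CP [simp]: "[] \<in> CP N"
  by (simp add: CP_def is_partition_def)

lemma Cons_in_AP: "(s, b) # l \<in> AP N \<longleftrightarrow>
    s \<le> N \<and> (let g = if b then 2 else 1 in g \<le> s \<and> l \<in> AP (s - g))"
proof -
  define g :: nat where "g = (if b then 2 else 1)"
  have *: "r \<le> N" if "s \<le> N" "r \<le> s - g" for r
    using that by simp
  have "(s, b) # l \<in> AP N \<longleftrightarrow> (overpartition ((s, b) # l) \<and> gap_condition ((s, b) # l))
      \<and> s \<le> N \<and> (\<forall>r\<in>set l. fst r \<le> N)"
    unfolding AP_def mem_Collect_eq by auto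
  also have "\<dots> \<longleftrightarrow> s \<le> N \<and> g \<le> s \<and> l \<in> AP (s - g)"
    unfolding overpartition_gap_condition_Cons AP_def Let_def fst_conv snd_conv
      g_def[symmetric] mem_Collect_eq
    using * by blast
  finally show ?thesis
    by (simp only: g_def Let_def)
qed

text \<open>An overlined part is the last of its size, so the tail is bounded by s - 1; a
  non-overlined one may be followed by parts of the same size.\<close>

lemma Cons_in_BP: "(s, b) # l \<in> BP N \<longleftrightarrow>
    0 < s \<and> s \<le> N \<and> (if b then l \<in> BP (s - 1) else s mod 4 = 2 \<and> l \<in> BP s)"
proof -
  have *: "r \<le> s \<and> r \<noteq> s \<longleftrightarrow> r \<le> s - 1" if "0 < s" for r
    using that by auto
  have "r \<le> N" if "s \<le> N" "r \<le> s" for r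
    using that by simp
  then show ?thesis
    unfolding BP_def mem_Collect_eq overpartition_Cons by (cases b) (auto simp: *)
qed

lemma Cons_in_CP: "s # l \<in> CP N \<longleftrightarrow> 0 < s \<and> s \<le> N \<and> s mod 4 \<noteq> 0 \<and> l \<in> CP s"
  unfolding CP_def is_partition_def by (auto intro: order_trans)

section \<open>Decomposition by the largest part\<close>

lemma AP_0: "AP 0 = {[]}"
proof -
  have "l \<in> AP 0 \<longleftrightarrow> l = []" for l
    by (cases l) (auto simp: Cons_in_AP Let_def split: if_splits)
  then show ?thesis by blast
qed

lemma AP_1: "AP (Suc 0) = AP 0 \<union> (#) (1, False) ` AP 0" (is "_ = ?R")
proof -
  have "l \<in> AP (Suc 0) \<longleftrightarrow> l \<in> ?R" for l
    by (cases l) (auto simp: Cons_in_AP Let_def le_Suc_eq split: if_splits)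
  then show ?thesis by blast
qed

lemma AP_Suc_Suc: "AP (Suc (Suc N)) =
  (AP (Suc N) \<union> (#) (Suc (Suc N), False) ` AP (Suc N)) \<union> (#) (Suc (Suc N), True) ` AP N"
  (is "_ = ?R")
proof -
  have "l \<in> AP (Suc (Suc N)) \<longleftrightarrow> l \<in> ?R" for l
    by (cases l) (auto simp: Cons_in_AP Let_def le_Suc_eq[of _ "Suc N"] split: if_splits)
  then show ?thesis by blast
qed

lemma BP_0: "BP 0 = {[]}"
proof -
  have "l \<in> BP 0 \<longleftrightarrow> l = []" for l
    by (cases l) (auto simp: Cons_in_BP)
  then show ?thesis by blast
qed

text \<open>The set itself recurs on the right because a non-overlined part may be repeated. In the
  generating function this becomes the factor 1 - X^(N+1) on the left; \<open>CP_Suc\<close> works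
  alike.\<close>

lemma BP_Suc: "BP (Suc N) = (BP N \<union> (#) (Suc N, True) ` BP N) \<union>
    (if Suc N mod 4 = 2 then (#) (Suc N, False) ` BP (Suc N) else {})" (is "_ = ?R")
proof -
  have "l \<in> BP (Suc N) \<longleftrightarrow> l \<in> ?R" for l
    by (cases l) (auto simp: Cons_in_BP le_Suc_eq[of _ N] split: if_splits)
  then show ?thesis by blast
qed

lemma CP_0: "CP 0 = {[]}"
proof -
  have "l \<in> CP 0 \<longleftrightarrow> l = []" for l
    by (cases l) (auto simp: Cons_in_CP)
  then show ?thesis by blast
qed

lemma CP_Suc: "CP (Suc N) = CP N \<union> (if Suc N mod 4 = 0 then {} else (#) (Suc N) ` CP (Suc N))"
  (is "_ = ?R")
proof -
  have "l \<in> CP (Suc N) \<longleftrightarrow> l \<in> ?R" for l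
    by (cases l) (auto simp: Cons_in_CP le_Suc_eq[of _ N])
  then show ?thesis by blast
qed

lemma finite_weight_AP: "finite {l \<in> AP N. weight l = n}"
  by (rule finite_subset[OF _ finite_overpartitions[of n]]) (auto simp: AP_def overpartition_def)

lemma finite_weight_BP: "finite {l \<in> BP N. weight l = n}"
  by (rule finite_subset[OF _ finite_overpartitions[of n]]) (auto simp: BP_def overpartition_def)

lemma finite_weight_CP: "finite {l \<in> CP N. sum_list l = n}"
  by (rule finite_subset[OF _ finite_partitions[of n]]) (auto simp: CP_def)

lemma finite_weight_Un:
  "finite {x \<in> S. w x = n} \<Longrightarrow> finite {x \<in> T. w x = n} \<Longrightarrow> finite {x \<in> S \<union> T. w x = n}"
  by (rule finite_subset[of _ "{x \<in> S. w x = n} \<union> {x \<in> T. w x = n}"]) auto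

lemma finite_weight_image:
  fixes w :: "'a \<Rightarrow> nat"
  assumes "\<And>n. finite {x \<in> S. w x = n}" "\<And>x. w (f x) = d + w x"
  shows "finite {x \<in> f ` S. w x = n}"
  by (rule finite_subset[of _ "f ` {x \<in> S. w x = n - d}"]) (use assms in auto)

section \<open>Recurrences and products for the generating functions\<close>

lemma gf_AP_0: "gf weight (AP 0) = 1"
  by (simp add: AP_0 gf_singleton)

lemma gf_AP_1: "gf weight (AP (Suc 0)) = 1 + fps_X"
proof -
  have "gf weight (AP (Suc 0)) = gf weight (AP 0) + gf weight ((#) (1, False) ` AP 0)"
    unfolding AP_1
    by (rule gf_Un) (auto simp: AP_0 intro: finite_subset[of _ "(#) (1, False) ` AP 0"])
  also have "gf weight ((#) (1, False) ` AP 0) = fps_X ^ 1 * gf weight (AP 0)"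
    by (rule gf_image) simp_all
  finally show ?thesis by (simp add: gf_AP_0)
qed

lemma gf_AP_Suc_Suc: "gf weight (AP (Suc (Suc N))) =
   (1 + fps_X ^ Suc (Suc N)) * gf weight (AP (Suc N)) + fps_X ^ Suc (Suc N) * gf weight (AP N)"
proof -
  let ?n = "Suc (Suc N)"
  have fin: "finite {l \<in> (#) (?n, b) ` AP M. weight l = n}" for b M n
    by (rule finite_weight_image[where d = ?n]) (simp_all add: finite_weight_AP)
  have im: "gf weight ((#) (?n, b) ` AP M) = fps_X ^ ?n * gf weight (AP M)" for b M
    by (rule gf_image) simp_all
  have disj: "AP (Suc N) \<inter> (#) (?n, b) ` S = {}" for b S
    by (auto simp: AP_def)
  have "gf weight (AP ?n) = gf weight (AP (Suc N) \<union> (#) (?n, False) ` AP (Suc N))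
      + gf weight ((#) (?n, True) ` AP N)"
    unfolding AP_Suc_Suc
  proof (rule gf_Un)
    show "(AP (Suc N) \<union> (#) (?n, False) ` AP (Suc N)) \<inter> (#) (?n, True) ` AP N = {}"
      unfolding Int_Un_distrib2 disj by auto
  qed (intro finite_weight_Un fin finite_weight_AP)+
  also have "gf weight (AP (Suc N) \<union> (#) (?n, False) ` AP (Suc N))
      = gf weight (AP (Suc N)) + gf weight ((#) (?n, False) ` AP (Suc N))"
    by (intro gf_Un fin finite_weight_AP disj)
  finally show ?thesis
    unfolding im by (simp only: distrib_right mult_1)
qed

lemma gf_BP_Suc:
  "Suc N mod 4 \<noteq> 2 \<Longrightarrow> gf weight (BP (Suc N)) = (1 + fps_X ^ Suc N) * gf weight (BP N)"
  "Suc N mod 4 = 2 \<Longrightarrow>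
     gf weight (BP (Suc N)) * (1 - fps_X ^ Suc N) = (1 + fps_X ^ Suc N) * gf weight (BP N)"
proof -
  have fin: "finite {l \<in> (#) (Suc N, b) ` BP M. weight l = n}" for b M n
    by (rule finite_weight_image[where d = "Suc N"]) (simp_all add: finite_weight_BP)
  have im: "gf weight ((#) (Suc N, b) ` BP M) = fps_X ^ Suc N * gf weight (BP M)" for b M
    by (rule gf_image) simp_all
  have disj: "BP N \<inter> (#) (Suc N, b) ` S = {}" for b S
    by (auto simp: BP_def)
  have 1: "gf weight (BP N \<union> (#) (Suc N, True) ` BP N) = (1 + fps_X ^ Suc N) * gf weight (BP N)"
    by (subst gf_Un) (simp_all only: fin finite_weight_BP im disj distrib_right mult_1)
  show "gf weight (BP (Suc N)) = (1 + fps_X ^ Suc N) * gf weight (BP N)" if "Suc N mod 4 \<noteq> 2"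
    using arg_cong[OF BP_Suc[of N], of "gf weight"] unfolding if_not_P[OF that] Un_empty_right 1 .
  show "gf weight (BP (Suc N)) * (1 - fps_X ^ Suc N) = (1 + fps_X ^ Suc N) * gf weight (BP N)"
    if "Suc N mod 4 = 2"
  proof -
    have "gf weight (BP (Suc N))
        = gf weight ((BP N \<union> (#) (Suc N, True) ` BP N) \<union> (#) (Suc N, False) ` BP (Suc N))"
      using arg_cong[OF BP_Suc[of N], of "gf weight"] unfolding if_P[OF that] .
    also have "\<dots> = gf weight (BP N \<union> (#) (Suc N, True) ` BP N)
        + gf weight ((#) (Suc N, False) ` BP (Suc N))"
    proof (rule gf_Un)
      show "(BP N \<union> (#) (Suc N, True) ` BP N) \<inter> (#) (Suc N, False) ` BP (Suc N) = {}"
        unfolding Int_Un_distrib2 disj by auto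
    qed (intro finite_weight_Un fin finite_weight_BP)+
    finally have "gf weight (BP (Suc N))
        = (1 + fps_X ^ Suc N) * gf weight (BP N) + fps_X ^ Suc N * gf weight (BP (Suc N))"
      unfolding 1 im .
    then show ?thesis
      unfolding right_diff_distrib mult_1_right diff_eq_eq mult.commute[of _ "fps_X ^ Suc N"] .
  qed
qed

lemma gf_CP_Suc:
  "Suc N mod 4 = 0 \<Longrightarrow> gf sum_list (CP (Suc N)) = gf sum_list (CP N)"
  "Suc N mod 4 \<noteq> 0 \<Longrightarrow> gf sum_list (CP (Suc N)) * (1 - fps_X ^ Suc N) = gf sum_list (CP N)"
proof -
  show "gf sum_list (CP (Suc N)) = gf sum_list (CP N)" if "Suc N mod 4 = 0"
    using arg_cong[OF CP_Suc[of N], of "gf sum_list"] unfolding if_P[OF that] Un_empty_right .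
  show "gf sum_list (CP (Suc N)) * (1 - fps_X ^ Suc N) = gf sum_list (CP N)" if "Suc N mod 4 \<noteq> 0"
  proof -
    have "gf sum_list (CP (Suc N)) = gf sum_list (CP N \<union> (#) (Suc N) ` CP (Suc N))"
      using arg_cong[OF CP_Suc[of N], of "gf sum_list"] unfolding if_not_P[OF that] .
    also have "\<dots> = gf sum_list (CP N) + gf sum_list ((#) (Suc N) ` CP (Suc N))"
    proof (rule gf_Un)
      show "CP N \<inter> (#) (Suc N) ` CP (Suc N) = {}"
        by (auto simp: CP_def)
      show "finite {l \<in> (#) (Suc N) ` CP (Suc N). sum_list l = n}" for n
        by (rule finite_weight_image[where d = "Suc N"]) (simp_all add: finite_weight_CP)
    qed (rule finite_weight_CP)
    also have "gf sum_list ((#) (Suc N) ` CP (Suc N)) = fps_X ^ Suc N * gf sum_list (CP (Suc N))"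
      by (rule gf_image) simp_all
    finally show ?thesis
      unfolding right_diff_distrib mult_1_right diff_eq_eq mult.commute[of _ "fps_X ^ Suc N"] .
  qed
qed

text \<open>Each block of four sizes contributes four overlining factors 1 + X^j and, from its one
  size congruent to 2 mod 4, a single denominator.\<close>

lemma gf_BP:
  "gf weight (BP (4 * M)) * (\<Prod>i<M. 1 - fps_X ^ (2 * (2 * i + 1))) = (\<Prod>i<4 * M. 1 + fps_X ^ Suc i)"
proof (induction M)
  case 0
  then show ?case by (simp add: BP_0 gf_singleton)
next
  case (Suc M)
  let ?g = "\<lambda>N. gf weight (BP N)" and ?X = "\<lambda>k. (fps_X :: rat fps) ^ k"
  let ?R = "\<Prod>i<M. 1 - ?X (2 * (2 * i + 1))"
  define N where "N = 4 * M"
  have N4: "4 * Suc M = Suc (Suc (Suc (Suc N)))" and N2: "2 * (2 * M + 1) = Suc (Suc N)"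
    by (simp_all add: N_def)
  have "N mod 4 = 0" by (simp add: N_def)
  then have mods: "Suc N mod 4 = 1" "Suc (Suc N) mod 4 = 2" "Suc (Suc (Suc N)) mod 4 = 3"
    "Suc (Suc (Suc (Suc N))) mod 4 = 0"
    by (simp_all add: mod_Suc)
  have step: "?g (Suc N) = (1 + ?X (Suc N)) * ?g N"
    "?g (Suc (Suc N)) * (1 - ?X (Suc (Suc N))) = (1 + ?X (Suc (Suc N))) * ?g (Suc N)"
    "?g (Suc (Suc (Suc N))) = (1 + ?X (Suc (Suc (Suc N)))) * ?g (Suc (Suc N))"
    "?g (Suc (Suc (Suc (Suc N)))) = (1 + ?X (Suc (Suc (Suc (Suc N))))) * ?g (Suc (Suc (Suc N)))"
    by (intro gf_BP_Suc; simp only: mods; simp)+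
  have "?g (4 * Suc M) * (\<Prod>i<Suc M. 1 - ?X (2 * (2 * i + 1)))
      = (1 + ?X (Suc (Suc (Suc (Suc N))))) * (1 + ?X (Suc (Suc (Suc N))))
        * (?g (Suc (Suc N)) * (1 - ?X (Suc (Suc N)))) * ?R"
    unfolding N4 step(3,4) prod.lessThan_Suc N2 by (simp only: ac_simps)
  also have "\<dots> = (1 + ?X (Suc (Suc (Suc (Suc N))))) * (1 + ?X (Suc (Suc (Suc N))))
        * (1 + ?X (Suc (Suc N))) * (1 + ?X (Suc N)) * (?g N * ?R)"
    unfolding step(1,2) by (simp only: ac_simps)
  also have "\<dots> = (\<Prod>i<4 * Suc M. 1 + ?X (Suc i))"
    unfolding Suc.IH[folded N_def] N4 prod.lessThan_Suc by (simp only: ac_simps)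
  finally show ?case .
qed

text \<open>The sizes not divisible by 4 are the odd numbers and the doubles of odd numbers; a block
  of four contains two of the former and one of the latter.\<close>

lemma gf_CP:
  "gf sum_list (CP (4 * M)) * (\<Prod>i<M. 1 - fps_X ^ (2 * (2 * i + 1)))
     * (\<Prod>i<2 * M. 1 - fps_X ^ (2 * i + 1)) = 1"
proof (induction M)
  case 0
  then show ?case by (simp add: CP_0 gf_singleton)
next
  case (Suc M)
  let ?g = "\<lambda>N. gf sum_list (CP N)" and ?X = "\<lambda>k. (fps_X :: rat fps) ^ k"
  let ?R = "\<Prod>i<M. 1 - ?X (2 * (2 * i + 1))" and ?O = "\<Prod>i<2 * M. 1 - ?X (2 * i + 1)"
  define N where "N = 4 * M"
  have N4: "4 * Suc M = Suc (Suc (Suc (Suc N)))" and N2: "2 * (2 * M + 1) = Suc (Suc N)"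
    and M2: "2 * Suc M = Suc (Suc (2 * M))"
    and N13: "2 * (2 * M) + 1 = Suc N" "2 * Suc (2 * M) + 1 = Suc (Suc (Suc N))"
    by (simp_all add: N_def)
  have "N mod 4 = 0" by (simp add: N_def)
  then have mods: "Suc N mod 4 = 1" "Suc (Suc N) mod 4 = 2" "Suc (Suc (Suc N)) mod 4 = 3"
    "Suc (Suc (Suc (Suc N))) mod 4 = 0"
    by (simp_all add: mod_Suc)
  have step: "?g (Suc N) * (1 - ?X (Suc N)) = ?g N"
    "?g (Suc (Suc N)) * (1 - ?X (Suc (Suc N))) = ?g (Suc N)"
    "?g (Suc (Suc (Suc N))) * (1 - ?X (Suc (Suc (Suc N)))) = ?g (Suc (Suc N))"
    "?g (Suc (Suc (Suc (Suc N)))) = ?g (Suc (Suc (Suc N)))"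
    by (intro gf_CP_Suc; simp only: mods; simp)+
  have "?g (4 * Suc M) * (\<Prod>i<Suc M. 1 - ?X (2 * (2 * i + 1)))
       * (\<Prod>i<2 * Suc M. 1 - ?X (2 * i + 1))
      = ?g (Suc (Suc (Suc N))) * (1 - ?X (Suc (Suc (Suc N)))) * (1 - ?X (Suc (Suc N)))
        * (1 - ?X (Suc N)) * (?R * ?O)"
    unfolding N4 M2 step(4) prod.lessThan_Suc N2 N13 by (simp only: ac_simps)
  also have "\<dots> = ?g N * ?R * ?O"
    unfolding step(1-3) by (simp only: ac_simps)
  also have "\<dots> = 1"
    using Suc.IH by (simp only: N_def)
  finally show ?case .
qed

section \<open>Reading off the coefficients\<close>

lemma A_eq_gf:
  assumes "n \<le> N"
  shows "of_nat (A n) = fps_nth (gf weight (AP N)) n"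
proof -
  \<comment> \<open>No part exceeds the total n, so the bound N does not restrict the objects
    counted.\<close>
  have "fst p \<le> weight l" if "p \<in> set l" for p and l :: "opart list"
    using that member_le_sum_list[of "fst p" "map fst l"] by auto
  with assms have "{l. is_overpartition n l \<and> gap_condition l} = {l \<in> AP N. weight l = n}"
    unfolding is_overpartition_iff_weight[of n] AP_def by fastforce
  then show ?thesis by (simp add: A_def gf_def)
qed

lemma B_eq_gf:
  assumes "n \<le> N"
  shows "of_nat (B n) = fps_nth (gf weight (BP N)) n"
proof -
  have "fst p \<le> weight l" if "p \<in> set l" for p and l :: "opart list"
    using that member_le_sum_list[of "fst p" "map fst l"] by auto
  with assms have "{l. is_overpartition n l \<and> (\<forall>p \<in> set l. \<not> overlined p \<longrightarrow> size_of p mod 4 = 2)}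
      = {l \<in> BP N. weight l = n}"
    unfolding is_overpartition_iff_weight[of n] BP_def by fastforce
  then show ?thesis by (simp add: B_def gf_def)
qed

lemma C_eq_gf:
  assumes "n \<le> N"
  shows "of_nat (C n) = fps_nth (gf sum_list (CP N)) n"
proof -
  have "p \<le> sum_list l" if "p \<in> set l" for p and l :: "nat list"
    using that by (simp add: member_le_sum_list)
  with assms have "{l. is_partition n l \<and> (\<forall>p \<in> set l. p mod 4 \<noteq> 0)} = {l \<in> CP N. sum_list l = n}"
    unfolding CP_def is_partition_def by fastforce
  then show ?thesis by (simp add: C_def gf_def)
qed

theorem theorem1p3:
  fixes n :: nat
  shows "A n = B n \<and> B n = C n"
proof -
  \<comment> \<open>With this choice N = 4 * M and M meet the bounds of
    \<open>lebesgue_cong_upto\<close>, N has the form required by \<open>gf_BP\<close> and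
    \<open>gf_CP\<close>, and every discarded tail has exponents above n.\<close>
  define M where "M = 2 * n"
  define P where "P N = (\<Prod>i<N. 1 + (fps_X :: rat fps) ^ Suc i)" for N
  define E where "E = (\<Prod>i<M. 1 + (fps_X :: rat fps) ^ (2 * Suc i))"
  define R where "R = (\<Prod>i<M. 1 - (fps_X :: rat fps) ^ (2 * (2 * i + 1)))"
  define Q where "Q = (\<Prod>i<2 * M. 1 - (fps_X :: rat fps) ^ (2 * i + 1))"
  define a where "a = gf weight (AP (4 * M))"
  define b where "b = gf weight (BP (4 * M))"
  define c where "c = gf sum_list (CP (4 * M))"
  have a: "cong_upto n a (P (4 * M) * E)"
    unfolding a_def P_def E_def
    by (rule lebesgue_cong_upto) (simp_all add: gf_AP_0 gf_AP_1 gf_AP_Suc_Suc M_def del: power_Suc)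
  have b: "b * R = P (4 * M)" and c: "c * R * Q = 1"
    unfolding b_def c_def R_def Q_def P_def by (rule gf_BP gf_CP)+
  \<comment> \<open>Euler's identity in base X^2: the exponents in \<open>R\<close> are doubled odd
    numbers, those in \<open>E\<close> doubled integers.\<close>
  have "R * E = (\<Prod>i<M. 1 - fps_X ^ (2 * Suc (M + i)))"
    using euler_odd_finite[of "fps_X ^ 2 :: rat fps" M]
    unfolding R_def E_def power_mult[symmetric] .
  moreover have "cong_upto n (\<Prod>i<M. 1 - fps_X ^ (2 * Suc (M + i))) 1"
    by (rule cong_upto_prod_1) (simp add: M_def)
  ultimately have RE: "cong_upto n (R * E) 1" by (simp only:)
  have "Q * P (2 * M) = (\<Prod>i<2 * M. 1 - fps_X ^ Suc (2 * M + i))"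
    unfolding Q_def P_def by (rule euler_odd_finite)
  moreover have "cong_upto n (\<Prod>i<2 * M. 1 - fps_X ^ Suc (2 * M + i)) 1"
    by (rule cong_upto_prod_1) (simp add: M_def)
  ultimately have QP2: "cong_upto n (Q * P (2 * M)) 1"
    by (simp only:)
  \<comment> \<open>Euler's identity pairs \<open>Q\<close> with only the first 2 * M factors of
    \<open>P (4 * M)\<close>; the others are 1 to this precision.\<close>
  have P4: "P (4 * M) = P (2 * M) * (\<Prod>i<2 * M. 1 + fps_X ^ Suc (2 * M + i))"
    using prod_lessThan_add[of _ "2 * M" "2 * M"] by (simp add: P_def del: power_Suc)
  have "cong_upto n (\<Prod>i<2 * M. 1 + fps_X ^ Suc (2 * M + i)) 1"
    by (rule cong_upto_prod_1) (simp add: M_def)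
  from cong_upto_mult[OF QP2 this] have QP: "cong_upto n (Q * P (4 * M)) 1"
    by (simp only: P4 mult.assoc mult_1)
  \<comment> \<open>Substituting P = b R gives a = P E = b (R E) = b modulo X^(n+1).\<close>
  have "cong_upto n a (b * (R * E))"
    using a by (simp add: b[symmetric] mult.assoc)
  also have "cong_upto n (b * (R * E)) (b * 1)"
    by (intro cong_upto_mult cong_upto_refl RE)
  finally have ab: "cong_upto n a b" by simp
  \<comment> \<open>Multiplying by c R Q = 1 and regrouping gives b = c Q (b R) = c (Q P), which is
    c modulo X^(n+1).\<close>
  have "b = (c * R * Q) * b" by (simp add: c)
  also have "\<dots> = c * (Q * P (4 * M))"
    unfolding b[symmetric] by (simp only: ac_simps)
  also have "cong_upto n \<dots> (c * 1)"
    by (intro cong_upto_mult cong_upto_refl QP)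
  finally have bc: "cong_upto n b c" by simp
  have "n \<le> 4 * M" by (simp add: M_def)
  then have "(of_nat (A n) :: rat) = of_nat (B n)" "(of_nat (B n) :: rat) = of_nat (C n)"
    using cong_upto_nth[OF ab] cong_upto_nth[OF bc]
    unfolding a_def b_def c_def by (simp_all add: A_eq_gf B_eq_gf C_eq_gf)
  then show ?thesis by simp
qed

end
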